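(* Every $\alpha$-valuation of a complete bipartite graph $K_{a,b}$ can be obtained from the trivial $\alpha$-valuation $(\{0\},\{1\})$ of $K_{1,1}$ by an alternating sequence of Blowup I and Blowup II operations.
   Context: An $\alpha$-valuation of $K_{a,b}$ is a one-to-one labelling of its vertices by elements of $\{0,1,\dots,ab\}$ such that the absolute differences of endpoint labels over all edges are exactly $\{1,\dots,ab\}$, and there is a value $x$ such that every edge joins a vertex with label $\le x$ to a vertex with label $>x$. Vertices are identified with labels, and the valuation is recorded as the pair $(V^{\sf small},V^{\sf large})$ of the sets of labels $\le x$ and $>x$ respectively. For an integer $\ell>1$: the Blowup I operation with parameter $\ell$ sends $(W^{\sf small},W^{\sf large})$ to $(\{\ell i+j: i\in W^{\sf small},\,0\le j\le \ell-1\},\ \{\ell y: y\in W^{\sf large}\})$ (an $\alpha$-valuation of $K_{\ell a,b}$ when the input is one of $K_{a,b}$ with $|W^{\sf small}|=a$); the Blowup II operation with parameter $\ell$ sends $(W^{\sf small},W^{\sf large})$ to $(\{\ell i: i\in W^{\sf small}\},\ \{\ell y-j: y\in W^{\sf large},\,0\le j\le \ell-1\})$ (an $\alpha$-valuation of $K_{a,\ell b}$). An alternating sequence is one in which consecutive operations are of different types (each with its own parameter $\ell$). *)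

theory Defs
  imports Main
begin

definition K_verts :: "nat \<Rightarrow> nat \<Rightarrow> (nat + nat) set" where
  "K_verts a b = {..<a} <+> {..<b}"

definition K_edges :: "nat \<Rightarrow> nat \<Rightarrow> (nat + nat) set set" where
  "K_edges a b = {{Inl i, Inr j} | i j. i < a \<and> j < b}"

text \<open>The threshold \<open>x\<close> is an explicit argument. Either side of the bipartition
  may be the one carrying the labels \<open>\<le> x\<close>. Labels are integers so that neither the edge
  differences nor \<open>l * y - j\<close> below are truncated.\<close>

definition alpha_valuation :: "nat \<Rightarrow> nat \<Rightarrow> (nat + nat \<Rightarrow> int) \<Rightarrow> int \<Rightarrow> bool" where
  "alpha_valuation a b f x \<longleftrightarrow>
     inj_on f (K_verts a b) \<and>
     f ` K_verts a b \<subseteq> {0..int (a * b)} \<and>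
     {\<bar>f u - f v\<bar> | u v. {u, v} \<in> K_edges a b} = {1..int (a * b)} \<and>
     (\<forall>e \<in> K_edges a b. \<exists>u v. e = {u, v} \<and> f u \<le> x \<and> f v > x)"

definition V_small :: "nat \<Rightarrow> nat \<Rightarrow> (nat + nat \<Rightarrow> int) \<Rightarrow> int \<Rightarrow> int set" where
  "V_small a b f x = {k \<in> f ` K_verts a b. k \<le> x}"

definition V_large :: "nat \<Rightarrow> nat \<Rightarrow> (nat + nat \<Rightarrow> int) \<Rightarrow> int \<Rightarrow> int set" where
  "V_large a b f x = {k \<in> f ` K_verts a b. k > x}"

datatype blowup_type = I | II

fun blowup :: "blowup_type \<times> int \<Rightarrow> int set \<times> int set \<Rightarrow> int set \<times> int set" where
  "blowup (I, l) (S, L) =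
     ({l * i + j | i j. i \<in> S \<and> 0 \<le> j \<and> j \<le> l - 1}, {l * y | y. y \<in> L})"
| "blowup (II, l) (S, L) =
     ({l * i | i. i \<in> S}, {l * y - j | y j. y \<in> L \<and> 0 \<le> j \<and> j \<le> l - 1})"

definition alternating_blowups :: "(blowup_type \<times> int) list \<Rightarrow> bool" where
  "alternating_blowups ops \<longleftrightarrow>
     (\<forall>(t, l) \<in> set ops. l > 1) \<and> successively (\<lambda>p q. fst p \<noteq> fst q) ops"

end

theory Submission
  imports Defs
begin

text \<open>If \<open>n\<close> is the number of edges, then the small labels \<open>A\<close> and the reflected large labels
  \<open>B = n - L\<close> satisfy \<open>A \<oplus> B = {0..<n}\<close> with unique representations. If \<open>1 \<in> A\<close> and \<open>l\<close> is
  the least number outside \<open>A\<close>, then, block by block, \<open>A\<close> is a union of complete blocks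
  \<open>{k * l..<k * l + l}\<close> and \<open>B\<close> consists of multiples of \<open>l\<close> (de Bruijn). So the last operation
  is a Blowup I with parameter \<open>l\<close>, and, because \<open>l \<notin> A\<close>, the quotient tiling does not have
  \<open>1\<close> in its first factor, which forces alternation. The case \<open>1 \<in> B\<close> is symmetric.\<close>

section \<open>Unique sum decompositions of an initial segment\<close>

definition tiles :: "nat \<Rightarrow> nat set \<Rightarrow> nat set \<Rightarrow> bool" where
  "tiles n A B \<longleftrightarrow>
     (\<forall>a\<in>A. \<forall>b\<in>B. a + b < n) \<and>
     (\<forall>m<n. \<exists>a\<in>A. \<exists>b\<in>B. m = a + b) \<and>
     (\<forall>a\<in>A. \<forall>b\<in>B. \<forall>a'\<in>A. \<forall>b'\<in>B. a + b = a' + b' \<longrightarrow> a = a' \<and> b = b')"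

lemma tiles_less: "tiles n A B \<Longrightarrow> a \<in> A \<Longrightarrow> b \<in> B \<Longrightarrow> a + b < n"
  unfolding tiles_def by blast

lemma tiles_ex:
  assumes "tiles n A B" "m < n"
  obtains a b where "a \<in> A" "b \<in> B" "m = a + b"
  using assms unfolding tiles_def by blast

lemma tiles_unique:
  "tiles n A B \<Longrightarrow> a \<in> A \<Longrightarrow> b \<in> B \<Longrightarrow> a' \<in> A \<Longrightarrow> b' \<in> B \<Longrightarrow> a + b = a' + b' \<Longrightarrow> a = a' \<and> b = b'"
  unfolding tiles_def by blast

lemma tiles_commute:
  assumes "tiles n A B"
  shows "tiles n B A"
  unfolding tiles_def
proof (intro conjI ballI allI impI)
  show "b + a < n" if "a \<in> A" "b \<in> B" for a b
    using tiles_less[OF assms that] by simp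
  show "\<exists>b\<in>B. \<exists>a\<in>A. m = b + a" if "m < n" for m
    using tiles_ex[OF assms that] by (metis add.commute)
  fix b a b' a' assume "b \<in> B" "a \<in> A" "b' \<in> B" "a' \<in> A" "b + a = b' + a'"
  then show "b = b'" "a = a'"
    using tiles_unique[OF assms, of a b a' b'] by (simp_all add: add.commute)
qed

lemma tiles_zero:
  assumes "tiles n A B" "n > 0"
  shows "0 \<in> A" "0 \<in> B"
proof -
  obtain a b where "a \<in> A" "b \<in> B" "0 = a + b"
    using tiles_ex[OF assms] .
  then show "0 \<in> A" "0 \<in> B" by auto
qed

lemma tiles_1:
  assumes "tiles 1 A B"
  shows "A = {0}" "B = {0}"
proof -
  have z: "0 \<in> A" "0 \<in> B"
    using tiles_zero[OF assms] by simp_all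
  show "A = {0}" using z tiles_less[OF assms _ z(2)] by fastforce
  show "B = {0}" using z tiles_less[OF assms z(1)] by fastforce
qed

section \<open>Block structure and division by the block length\<close>

text \<open>Strong induction on the block index: decompose the block's first element
  \<open>k * l\<close> as \<open>a + b\<close>. If both summands are smaller, translates of an
  earlier block fill this one and neither set meets it. If \<open>b = 0\<close>, the block lies in
  \<open>A\<close> and misses \<open>B\<close>. If \<open>a = 0\<close>, it meets \<open>B\<close>
  only in \<open>k * l\<close> and misses \<open>A\<close>. The last conjunct, that no block
  straddles \<open>n\<close>, later yields divisibility of \<open>n\<close>.\<close>

lemma tiles_block:
  assumes T: "tiles n A B" and n: "n > 0"
    and init: "\<And>j. j < l \<Longrightarrow> j \<in> A" and l: "l \<notin> A" "l > 0"
  shows "(\<forall>j<l. (k * l + j \<in> A \<longleftrightarrow> k * l \<in> A) \<and> (k * l + j \<in> B \<longrightarrow> j = 0)) \<and>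
         (k * l < n \<longrightarrow> k * l + l \<le> n)"
proof (induction k rule: less_induct)
  case (less k)
  note zA = tiles_zero(1)[OF T n] and zB = tiles_zero(2)[OF T n]
  note unique = tiles_unique[OF T] and bound = tiles_less[OF T]
  \<comment> \<open>Otherwise \<open>b\<close> would have the two representations
    \<open>0 + b\<close> and \<open>b + 0\<close>.\<close>
  have B_init: "b = 0" if "b \<in> B" "b < l" for b
    using unique[OF zA that(1) init[OF that(2)] zB] by simp
  \<comment> \<open>Earlier blocks are all or nothing for \<open>A\<close>, so \<open>a\<close> may
    be moved anywhere within its own block.\<close>
  have A_lower: "a - a mod l + j \<in> A" if "a \<in> A" "a < k * l" "j < l" for a j
  proof -
    have q: "a div l < k" using that(2) l(2) by (simp add: less_mult_imp_div_less)
    have "a div l * l + a mod l \<in> A" using that(1) by simp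
    then have "a div l * l + j \<in> A"
      using less.IH[OF q] that(3) mod_less_divisor[OF l(2), of a] by blast
    then show ?thesis by (simp add: minus_mod_eq_div_mult)
  qed
  have B_lower: "b mod l = 0" if "b \<in> B" "b < k * l" for b
  proof -
    have q: "b div l < k" using that(2) l(2) by (simp add: less_mult_imp_div_less)
    have "b div l * l + b mod l \<in> B" using that(1) by simp
    then show ?thesis
      using less.IH[OF q] mod_less_divisor[OF l(2), of b] by blast
  qed
  show ?case
  proof (cases "k * l < n")
    case False
    have "k * l + j \<notin> A" "k * l + j \<notin> B" for j
      using False bound[OF _ zB, of "k * l + j"] bound[OF zA, of "k * l + j"] by auto
    moreover from this(1)[of 0] have "k * l \<notin> A" by simp
    ultimately show ?thesis using False by auto
  next
    case True
    obtain a b where ab: "a \<in> A" "b \<in> B" "k * l = a + b"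
      using tiles_ex[OF T True] .
    consider "k = 0" | "k > 0" "a < k * l" "b < k * l" | "k > 0" "b = 0" | "k > 0" "a = 0"
      using ab(3) by linarith
    then show ?thesis
    proof cases
      case 1
      have "l - 1 \<in> A" using init l(2) by simp
      then have "l \<le> n" using bound[OF _ zB] by fastforce
      then show ?thesis using 1 init zA B_init by auto
    next
      case 2
      have "b mod l = 0" using B_lower ab(2) 2(3) .
      then have "a mod l = 0" using ab(3)
        by (metis mod_0_imp_dvd dvd_add_left_iff dvd_triv_right mod_eq_0_iff_dvd)
      \<comment> \<open>Here \<open>a\<close> starts an earlier block contained in \<open>A\<close>,
        so \<open>(a + j) + b\<close> already represents every element of block \<open>k\<close>. A
        member of \<open>A\<close> or \<open>B\<close> in that block would give a second
        representation using 0.\<close>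
      then have aj: "a + j \<in> A" if "j < l" for j
        using A_lower[OF ab(1) 2(2) that] by simp
      have notA: "k * l + j \<notin> A" if "j < l" for j
        using unique[OF _ zB aj[OF that] ab(2)] ab(3) 2(2) by fastforce
      have notB: "k * l + j \<notin> B" if "j < l" for j
        using unique[OF zA _ aj[OF that] ab(2)] ab(3) 2(3) by fastforce
      have "a + (l - 1) + b < n" using bound[OF aj[of "l - 1"] ab(2)] l(2) by simp
      then have "k * l + l \<le> n" using ab(3) by simp
      then show ?thesis using notA notA[of 0] notB l(2) by auto
    next
      case 3
      have klA: "k * l \<in> A" using ab 3 by simp
      have "l \<le> k * l" using 3(1) by simp
      then have "l < n" using True by linarith
      then obtain c d where cd: "c \<in> A" "d \<in> B" "l = c + d"
        using tiles_ex[OF T] by blast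
      \<comment> \<open>The case \<open>d = 0\<close> would put \<open>l\<close> into
        \<open>A\<close>, and \<open>B\<close> has no element strictly between 0 and
        \<open>l\<close>; hence \<open>l\<close> itself is in \<open>B\<close>.\<close>
      have "d \<noteq> 0" using cd l(1) by (metis add.right_neutral)
      then have "d = l" using B_init[OF cd(2)] cd(3) by linarith
      then have lB: "l \<in> B" using cd by simp
      have notB: "k * l + j \<notin> B" if "j < l" for j
      proof
        assume H: "k * l + j \<in> B"
        show False
        proof (cases "j = 0")
          case True
          then show False using unique[OF zA H klA zB] 3(1) l(2) by simp
        next
          case False
          \<comment> \<open>The sum \<open>(l - j) + (k * l + j)\<close> equals
            \<open>k * l + l\<close>, which is already represented with \<open>k * l\<close> in
            \<open>A\<close> and \<open>l\<close> in \<open>B\<close>.\<close>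
          then have "l - j \<in> A" using init that by simp
          from unique[OF this H klA lB] have "l - j = k * l" using that by simp
          then show False using False \<open>l \<le> k * l\<close> that by linarith
        qed
      qed
      have le: "k * l + l \<le> n" using bound[OF klA lB] by simp
      have inA: "k * l + j \<in> A" if j: "j < l" for j
      proof -
        have "k * l + j < n" using le j by simp
        then obtain c d where cd: "c \<in> A" "d \<in> B" "k * l + j = c + d"
          using tiles_ex[OF T] by blast
        \<comment> \<open>A larger \<open>d\<close> would lie in block \<open>k\<close>, which
          \<open>B\<close> avoids.\<close>
        have d: "d < k * l"
        proof (rule ccontr)
          assume "\<not> d < k * l"
          then have "d = k * l + (d - k * l)" "d - k * l < l" using cd(3) j by auto
          then show False using notB cd(2) by metis
        qed
        show ?thesis
        proof (cases "c < k * l")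
          case False
          then have "d = 0" using B_init[OF cd(2)] cd(3) j by simp
          then show ?thesis using cd by simp
        next
          case True
          \<comment> \<open>As \<open>d\<close> is a multiple of \<open>l\<close>, \<open>c\<close>
            has residue \<open>j\<close>. Moving \<open>c\<close> down to its block start gives
            \<open>(c - j) + d = k * l\<close>, a second representation of
            \<open>k * l + 0\<close>.\<close>
          have dm: "d mod l = 0" using B_lower cd(2) d .
          have "(c + d) mod l = j" using j by (simp flip: cd(3))
          moreover have "(c + d) mod l = c mod l"
            using dm by (metis add.right_neutral mod_add_right_eq)
          ultimately have cm: "c mod l = j" by simp
          have c0: "c - j \<in> A" using A_lower[OF cd(1) True l(2)] cm by simp
          have "j \<le> c" using cm by (metis mod_less_eq_dividend)
          then have "c - j + d = k * l + 0" using cd(3) by simp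
          from unique[OF c0 cd(2) klA zB this] have "c - j = k * l" by simp
          then show ?thesis using True by simp
        qed
      qed
      show ?thesis using inA klA notB le by auto
    next
      case 4
      have klB: "k * l \<in> B" using ab 4 by simp
      have notB: "j = 0" if "j < l" "k * l + j \<in> B" for j
        using unique[OF zA that(2) init[OF that(1)] klB] by simp
      have notA: "k * l + j \<notin> A" if "j < l" for j
        using unique[OF _ zB init[OF that] klB] 4(1) l(2) by fastforce
      have "l - 1 + k * l < n" using bound[OF init[of "l - 1"] klB] l(2) by simp
      then have "k * l + l \<le> n" by simp
      then show ?thesis using notA notA[of 0] notB l(2) by auto
    qed
  qed
qed

text \<open>One step of peeling off an operation: \<open>l\<close> is the length of the initial run
  of \<open>A\<close>, and everything is divided by \<open>l\<close>. The conclusion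
  \<open>1 \<notin> A'\<close> restates \<open>l \<notin> A\<close>; it is what prevents two
  successive steps of the same type.\<close>

lemma tiles_reduce:
  assumes T: "tiles n A B" and n: "n > 0" and one: "1 \<in> A"
  obtains l n' A' B' where "l > 1" "n = l * n'" "n' > 0" "tiles n' A' B'" "1 \<notin> A'"
    "A = {l * i + j | i j. i \<in> A' \<and> j < l}" "B = {l * i | i. i \<in> B'}"
proof -
  note zA = tiles_zero(1)[OF T n] and zB = tiles_zero(2)[OF T n]
  define l where "l = (LEAST m. m \<notin> A)"
  \<comment> \<open>Since 0 is in \<open>B\<close>, all elements of \<open>A\<close> are below
    \<open>n\<close>; so \<open>n\<close> witnesses that the least number outside \<open>A\<close>
    exists.\<close>
  have "n \<notin> A" using tiles_less[OF T _ zB] by fastforce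
  then have lA: "l \<notin> A" unfolding l_def by (rule LeastI)
  have init: "j \<in> A" if "j < l" for j
    using not_less_Least that unfolding l_def by blast
  have "l \<noteq> 0" "l \<noteq> 1" using lA zA one by metis+
  then have l1: "l > 1" and l0: "l > 0" by auto
  note block = tiles_block[OF T n init lA l0]
  have split: "m = l * (m div l) + m mod l" "m mod l < l" for m using l0 by simp_all
  have A_iff: "m \<in> A \<longleftrightarrow> l * (m div l) \<in> A" for m
    using block[of "m div l"] split[of m] by (metis mult.commute)
  have B_dvd: "l dvd m" if "m \<in> B" for m
    using block[of "m div l"] split[of m] that by (metis mult.commute mod_0_imp_dvd)
  \<comment> \<open>Otherwise the block starting at \<open>n div l * l\<close> would begin below
    \<open>n\<close> and end beyond it.\<close>
  have "l dvd n"
  proof (rule ccontr)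
    assume "\<not> l dvd n"
    then have "n mod l > 0" by (simp add: mod_greater_zero_iff_not_dvd)
    moreover have "n = n div l * l + n mod l" by simp
    ultimately have "n div l * l < n" "\<not> n div l * l + l \<le> n"
      using split(2)[of n] by linarith+
    then show False using block[of "n div l"] by blast
  qed
  then obtain n' where n': "n = l * n'" ..
  define A' where "A' = {k. l * k \<in> A}"
  define B' where "B' = {k. l * k \<in> B}"
  have "tiles n' A' B'"
    unfolding tiles_def
  proof (intro conjI ballI allI impI)
    fix a b assume "a \<in> A'" "b \<in> B'"
    then have "l * a + l * b < l * n'"
      using tiles_less[OF T] unfolding A'_def B'_def n' by blast
    then show "a + b < n'" using l0 by (simp flip: distrib_left)
  next
    fix m assume "m < n'"
    then have "l * m < n" using n' l0 by simp
    then obtain a b where ab: "a \<in> A" "b \<in> B" "l * m = a + b" using tiles_ex[OF T] by blast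
    have "l dvd b" using B_dvd ab(2) .
    \<comment> \<open>Both \<open>l * m\<close> and \<open>b\<close> are multiples of
      \<open>l\<close>, hence so is \<open>a\<close>, and the representation descends to the
      quotient.\<close>
    moreover from this have "l dvd a" using ab(3) by (metis dvd_add_left_iff dvd_triv_left)
    ultimately obtain a' b' where "a = l * a'" "b = l * b'" by (elim dvdE)
    then show "\<exists>a\<in>A'. \<exists>b\<in>B'. m = a + b"
      using ab l0 by (auto simp: A'_def B'_def simp flip: distrib_left)
  next
    fix a b a' b' assume *: "a \<in> A'" "b \<in> B'" "a' \<in> A'" "b' \<in> B'" "a + b = a' + b'"
    then have "l * a + l * b = l * a' + l * b'" by (simp flip: distrib_left)
    then have "l * a = l * a' \<and> l * b = l * b'"
      using * tiles_unique[OF T] unfolding A'_def B'_def by blast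
    then show "a = a'" "b = b'" using l0 by simp_all
  qed
  moreover have "A = {l * i + j | i j. i \<in> A' \<and> j < l}"
  proof (intro equalityI subsetI)
    fix m assume "m \<in> A"
    then have "m div l \<in> A'" using A_iff by (simp add: A'_def)
    then show "m \<in> {l * i + j | i j. i \<in> A' \<and> j < l}" using split[of m] by blast
  next
    fix m assume "m \<in> {l * i + j | i j. i \<in> A' \<and> j < l}"
    then obtain i j where "m = l * i + j" "l * i \<in> A" "j < l" by (auto simp: A'_def)
    then show "m \<in> A" using A_iff[of m] by simp
  qed
  moreover have "B = {l * i | i. i \<in> B'}"
    using B_dvd by (auto simp: B'_def elim!: dvdE)
  moreover have "1 \<notin> A'" using lA by (simp add: A'_def)
  moreover have "n' > 0" using n n' by simp
  ultimately show thesis using that l1 n' by blast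
qed

section \<open>Blowups in reflected coordinates and the induction on tilings\<close>

lemma int_image_blocks:
  "int ` {l * i + j | i j. i \<in> A \<and> j < l} =
     {int l * i + j | i j. i \<in> int ` A \<and> 0 \<le> j \<and> j \<le> int l - 1}" (is "?L = ?R")
proof (intro equalityI subsetI)
  fix y assume "y \<in> ?L"
  then obtain i j where "y = int (l * i + j)" "i \<in> A" "j < l" by blast
  then have "y = int l * int i + int j" "int i \<in> int ` A" "0 \<le> int j" "int j \<le> int l - 1"
    by auto
  then show "y \<in> ?R" by blast
next
  fix y assume "y \<in> ?R"
  then obtain i j where "y = int l * int i + j" "i \<in> A" "0 \<le> j" "j \<le> int l - 1" by blast
  then have "y = int (l * i + nat j)" "nat j < l" by auto
  then show "y \<in> ?L" using \<open>i \<in> A\<close> by blast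
qed

lemma int_image_multiples:
  "int ` {l * i | i. i \<in> B} = {int l * i | i. i \<in> int ` B}"
  by (auto simp: image_def)

text \<open>As \<open>l * (n - b) = l * n - l * b\<close>, scaling the large labels scales their
  reflections, with \<open>n\<close> replaced by \<open>l * n\<close>.\<close>

lemma blowup_I_int:
  "blowup (I, int l) (int ` A, (\<lambda>b. int n - b) ` int ` B) =
     (int ` {l * i + j | i j. i \<in> A \<and> j < l},
      (\<lambda>b. int (l * n) - b) ` int ` {l * i | i. i \<in> B})"
proof -
  have "{int l * y | y. y \<in> (\<lambda>b. int n - b) ` C} =
      (\<lambda>b. int (l * n) - b) ` {int l * i | i. i \<in> C}" for C
    by (simp add: setcompr_eq_image image_image right_diff_distrib)
  then show ?thesis
    unfolding int_image_blocks int_image_multiples blowup.simps by simp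
qed

text \<open>From \<open>l * (n - b) - j = l * n - (l * b + j)\<close>: after reflection, Blowup II
  acts as Blowup I with the two sets exchanged.\<close>

lemma blowup_II_int:
  "blowup (II, int l) (int ` A, (\<lambda>b. int n - b) ` int ` B) =
     (int ` {l * i | i. i \<in> A},
      (\<lambda>b. int (l * n) - b) ` int ` {l * i + j | i j. i \<in> B \<and> j < l})"
proof -
  have "{int l * y - j | y j. y \<in> (\<lambda>b. int n - b) ` C \<and> 0 \<le> j \<and> j \<le> int l - 1} =
      (\<lambda>b. int (l * n) - b) ` {int l * i + j | i j. i \<in> C \<and> 0 \<le> j \<and> j \<le> int l - 1}"
    (is "?L = ?R") for C
  proof (intro equalityI subsetI)
    fix z assume "z \<in> ?L"
    then obtain i j where "z = int (l * n) - (int l * i + j)" "i \<in> C" "0 \<le> j" "j \<le> int l - 1"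
      by (auto simp: algebra_simps)
    then show "z \<in> ?R" by blast
  next
    fix z assume "z \<in> ?R"
    then obtain i j where "z = int l * (int n - i) - j" "i \<in> C" "0 \<le> j" "j \<le> int l - 1"
      by (auto simp: algebra_simps)
    then show "z \<in> ?L" by blast
  qed
  then show ?thesis
    unfolding int_image_blocks int_image_multiples blowup.simps by simp
qed

lemma alternating_blowups_snoc:
  assumes "alternating_blowups ops" "l > 1" "ops \<noteq> [] \<Longrightarrow> fst (last ops) \<noteq> t"
  shows "alternating_blowups (ops @ [(t, l)])"
  using assms by (auto simp: alternating_blowups_def successively_append_iff)

text \<open>The third conjunct strengthens the induction: it ties the type of the last operation to
  the factor containing 1, so that the next operation can be shown to differ in type.\<close>

lemma tiles_imp_blowups:
  assumes "tiles n A B" "n > 0"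
  shows "\<exists>ops. alternating_blowups ops \<and>
           fold blowup ops ({0}, {1}) = (int ` A, (\<lambda>b. int n - b) ` int ` B) \<and>
           (ops \<noteq> [] \<longrightarrow> 1 \<in> (case fst (last ops) of I \<Rightarrow> A | II \<Rightarrow> B))"
  using assms
proof (induction n arbitrary: A B rule: less_induct)
  case (less n)
  note T = less.prems(1)
  consider "n = 1" | "n > 1" using less.prems(2) by linarith
  then show ?case
  proof cases
    case 1
    then show ?thesis using tiles_1[of A B] T
      by (intro exI[of _ "[]"]) (simp add: alternating_blowups_def)
  next
    case 2
    then obtain a b where "a \<in> A" "b \<in> B" "1 = a + b" using tiles_ex[OF T] by blast
    \<comment> \<open>One of two natural numbers with sum 1 is 1; which factor it belongs to decides
      the type of the last operation.\<close>
    then consider "1 \<in> A" | "1 \<in> B" by (cases a) auto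
    then show ?thesis
    proof cases
      case 1
      obtain l n' A' B' where r: "l > 1" "n = l * n'" "n' > 0" "tiles n' A' B'" "1 \<notin> A'"
        "A = {l * i + j | i j. i \<in> A' \<and> j < l}" "B = {l * i | i. i \<in> B'}"
        using tiles_reduce[OF T less.prems(2) 1] .
      have "n' < n" using r by simp
      from less.IH[OF this r(4,3)] obtain ops where ops: "alternating_blowups ops"
        "fold blowup ops ({0}, {1}) = (int ` A', (\<lambda>b. int n' - b) ` int ` B')"
        "ops \<noteq> [] \<longrightarrow> 1 \<in> (case fst (last ops) of I \<Rightarrow> A' | II \<Rightarrow> B')" by blast
      \<comment> \<open>If \<open>ops\<close> ended in type \<open>I\<close>, the induction
        hypothesis would give \<open>1 \<in> A'\<close>.\<close>
      have "alternating_blowups (ops @ [(I, int l)])"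
        using ops(1,3) r(1,5) by (intro alternating_blowups_snoc) auto
      moreover have "fold blowup (ops @ [(I, int l)]) ({0}, {1}) =
          (int ` A, (\<lambda>b. int n - b) ` int ` B)"
        unfolding fold_append comp_apply ops(2) fold_simps blowup_I_int
        by (simp only: r(2,6,7))
      ultimately show ?thesis using 1 by (intro exI[of _ "ops @ [(I, int l)]"]) simp
    next
      case 2
      obtain l n' A' B' where r: "l > 1" "n = l * n'" "n' > 0" "tiles n' B' A'" "1 \<notin> B'"
        "B = {l * i + j | i j. i \<in> B' \<and> j < l}" "A = {l * i | i. i \<in> A'}"
        using tiles_reduce[OF tiles_commute[OF T] less.prems(2) 2] .
      have "n' < n" using r by simp
      from less.IH[OF this tiles_commute[OF r(4)] r(3)]
      obtain ops where ops: "alternating_blowups ops"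
        "fold blowup ops ({0}, {1}) = (int ` A', (\<lambda>b. int n' - b) ` int ` B')"
        "ops \<noteq> [] \<longrightarrow> 1 \<in> (case fst (last ops) of I \<Rightarrow> A' | II \<Rightarrow> B')" by blast
      have "alternating_blowups (ops @ [(II, int l)])"
        using ops(1,3) r(1,5) by (intro alternating_blowups_snoc) auto
      moreover have "fold blowup (ops @ [(II, int l)]) ({0}, {1}) =
          (int ` A, (\<lambda>b. int n - b) ` int ` B)"
        unfolding fold_append comp_apply ops(2) fold_simps blowup_II_int
        by (simp only: r(2,6,7))
      ultimately show ?thesis using 2 by (intro exI[of _ "ops @ [(II, int l)]"]) simp
    qed
  qed
qed

section \<open>From valuations to tilings\<close>

text \<open>Each edge has exactly one end with label at most \<open>x\<close>. By completeness, the
  label of \<open>Inl 0\<close> settles the whole opposite side, and \<open>Inr 0\<close> then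
  settles the side of \<open>Inl 0\<close>.\<close>

lemma alpha_valuation_sides:
  assumes "a \<ge> 1" "b \<ge> 1" "alpha_valuation a b f x"
  shows "V_small a b f x = f ` Inl ` {..<a} \<and> V_large a b f x = f ` Inr ` {..<b} \<or>
         V_small a b f x = f ` Inr ` {..<b} \<and> V_large a b f x = f ` Inl ` {..<a}"
proof -
  have edge: "f (Inl i) \<le> x \<longleftrightarrow> \<not> f (Inr j) \<le> x" if "i < a" "j < b" for i j
  proof -
    have e: "{Inl i, Inr j} \<in> K_edges a b" using that unfolding K_edges_def by blast
    have "\<forall>e\<in>K_edges a b. \<exists>u v. e = {u, v} \<and> f u \<le> x \<and> f v > x"
      using assms(3) unfolding alpha_valuation_def by (elim conjE)
    from bspec[OF this e] obtain u v where "{Inl i, Inr j} = {u, v}" "f u \<le> x" "f v > x"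
      by (elim exE conjE)
    then show ?thesis by (auto simp: doubleton_eq_iff)
  qed
  have verts: "f ` K_verts a b = f ` Inl ` {..<a} \<union> f ` Inr ` {..<b}"
    unfolding K_verts_def Plus_def by (simp add: image_Un)
  have *: "0 < a" "0 < b" using assms by auto
  show ?thesis
  proof (cases "f (Inl 0) \<le> x")
    case True
    then have R: "f (Inr j) > x" if "j < b" for j using edge[OF *(1) that] by simp
    then have "f (Inl i) \<le> x" if "i < a" for i using edge[OF that *(2)] *(2) by fastforce
    with R show ?thesis unfolding V_small_def V_large_def verts by force
  next
    case False
    then have R: "f (Inr j) \<le> x" if "j < b" for j using edge[OF *(1) that] by simp
    then have "f (Inl i) > x" if "i < a" for i using edge[OF that *(2)] *(2) by fastforce
    with R show ?thesis unfolding V_small_def V_large_def verts by force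
  qed
qed

text \<open>Injectivity comes from counting: the \<open>a * b\<close> pairs are mapped onto a set of
  \<open>a * b\<close> differences.\<close>

lemma alpha_valuation_differences:
  assumes "a \<ge> 1" "b \<ge> 1" "alpha_valuation a b f x"
  shows "bij_betw (\<lambda>(s, y). y - s) (V_small a b f x \<times> V_large a b f x) {1..int (a * b)}"
proof -
  let ?S = "V_small a b f x" and ?L = "V_large a b f x"
  note sides = alpha_valuation_sides[OF assms]
  have inj: "inj_on f (K_verts a b)"
    and diff: "{\<bar>f u - f v\<bar> | u v. {u, v} \<in> K_edges a b} = {1..int (a * b)}"
    using assms(3) unfolding alpha_valuation_def by blast+
  have "inj_on f (Inl ` {..<a})" "inj_on f (Inr ` {..<b})"
    using inj by (rule inj_on_subset, force simp: K_verts_def)+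
  then have cardf: "card (f ` Inl ` {..<a}) = a" "card (f ` Inr ` {..<b}) = b"
    by (simp_all add: card_image)
  have card: "card (?S \<times> ?L) = a * b"
    using sides by (auto simp: card_cartesian_product cardf)
  have fin: "finite (?S \<times> ?L)" using sides by auto
  have lt: "s \<le> x" "x < y" if "s \<in> ?S" "y \<in> ?L" for s y
    using that unfolding V_small_def V_large_def by auto
  have "{\<bar>f u - f v\<bar> | u v. {u, v} \<in> K_edges a b} =
      {\<bar>f (Inl i) - f (Inr j)\<bar> | i j. i < a \<and> j < b}" (is "?D = ?E")
  proof (intro equalityI subsetI)
    fix d assume "d \<in> ?D"
    then obtain u v i j where "d = \<bar>f u - f v\<bar>" "{u, v} = {Inl i, Inr j}" "i < a" "j < b"
      unfolding K_edges_def by blast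
    moreover from this have "d = \<bar>f (Inl i) - f (Inr j)\<bar>"
      by (auto simp: doubleton_eq_iff abs_minus_commute)
    ultimately show "d \<in> ?E" by blast
  next
    fix d assume "d \<in> ?E"
    then show "d \<in> ?D" unfolding K_edges_def by blast
  qed
  also have "\<dots> = (\<lambda>(s, y). \<bar>s - y\<bar>) ` (f ` Inl ` {..<a} \<times> f ` Inr ` {..<b})"
    by force
  \<comment> \<open>Either side may be the small one; symmetry of the absolute difference covers
    both cases.\<close>
  also have "\<dots> = (\<lambda>(s, y). \<bar>s - y\<bar>) ` (?S \<times> ?L)"
  proof -
    have "(\<lambda>(s, y). \<bar>s - y\<bar>) ` (P \<times> Q) = (\<lambda>(s, y). \<bar>s - y\<bar>) ` (Q \<times> P)" for P Q :: "int set"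
      by (subst product_swap[symmetric])
        (simp add: image_image split_def abs_minus_commute del: product_swap)
    then show ?thesis using sides by metis
  qed
  also have "\<dots> = (\<lambda>(s, y). y - s) ` (?S \<times> ?L)"
    using lt by (intro image_cong) fastforce+
  finally have img: "(\<lambda>(s, y). y - s) ` (?S \<times> ?L) = {1..int (a * b)}"
    using diff by simp
  moreover have "inj_on (\<lambda>(s, y). y - s) (?S \<times> ?L)"
    using fin by (rule eq_card_imp_inj_on) (simp add: img card del: of_nat_mult)
  ultimately show ?thesis unfolding bij_betw_def by blast
qed

text \<open>With \<open>n = a * b\<close>, \<open>s + (n - y) = n - (y - s)\<close>, so the
  bijection of differences with \<open>{1..n}\<close> turns into unique representation of
  \<open>{0..<n}\<close>. The range of the labels keeps \<open>nat\<close> from truncating.\<close>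

lemma alpha_valuation_tiles:
  assumes "a \<ge> 1" "b \<ge> 1" "alpha_valuation a b f x"
  shows "tiles (a * b) (nat ` V_small a b f x) (nat ` (\<lambda>y. int (a * b) - y) ` V_large a b f x)"
proof -
  let ?S = "V_small a b f x" and ?L = "V_large a b f x" and ?n = "int (a * b)"
  note bij = alpha_valuation_differences[OF assms]
  have "f ` K_verts a b \<subseteq> {0..?n}" using assms(3) unfolding alpha_valuation_def by blast
  then have S: "\<And>s. s \<in> ?S \<Longrightarrow> 0 \<le> s" and L: "\<And>y. y \<in> ?L \<Longrightarrow> y \<le> ?n"
    unfolding V_small_def V_large_def by auto
  have rng: "1 \<le> y - s" if "s \<in> ?S" "y \<in> ?L" for s y
    using bij_betwE[OF bij] that by fastforce
  have unique: "s = s' \<and> y = y'"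
    if "s \<in> ?S" "y \<in> ?L" "s' \<in> ?S" "y' \<in> ?L" "y - s = y' - s'" for s y s' y'
    using inj_onD[OF bij_betw_imp_inj_on[OF bij], of "(s, y)" "(s', y')"] that by simp
  show ?thesis
    unfolding tiles_def ball_simps bex_simps
  proof (intro conjI ballI allI impI)
    fix s y assume "s \<in> ?S" "y \<in> ?L"
    then show "nat s + nat (?n - y) < a * b"
      using S L rng[of s y] by (simp add: nat_less_iff flip: nat_add_distrib)
  next
    fix m assume "m < a * b"
    then have "?n - int m \<in> {1..?n}" by (simp del: of_nat_mult)
    then obtain s y where sy: "s \<in> ?S" "y \<in> ?L" "?n - int m = y - s"
      unfolding bij_betw_imp_surj_on[OF bij, symmetric] by auto
    then have "m = nat s + nat (?n - y)" using S L by (simp flip: nat_add_distrib)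
    then show "\<exists>s\<in>?S. \<exists>y\<in>?L. m = nat s + nat (?n - y)" using sy by blast
  next
    fix s y s' y'
    assume *: "s \<in> ?S" "y \<in> ?L" "s' \<in> ?S" "y' \<in> ?L"
      "nat s + nat (?n - y) = nat s' + nat (?n - y')"
    have "y - s = y' - s'" using *(5) S[OF *(1)] S[OF *(3)] L[OF *(2)] L[OF *(4)] by linarith
    with * unique have "s = s' \<and> y = y'" by blast
    then show "nat s = nat s'" "nat (?n - y) = nat (?n - y')" by simp_all
  qed
qed

theorem theorem2p17:
  fixes a b :: nat and f :: "nat + nat \<Rightarrow> int" and x :: int
  assumes "a \<ge> 1" and "b \<ge> 1"
    and "alpha_valuation a b f x"
  shows "\<exists>ops. alternating_blowups ops \<and>
           fold blowup ops ({0}, {1}) = (V_small a b f x, V_large a b f x)"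
proof -
  let ?S = "V_small a b f x" and ?L = "V_large a b f x" and ?n = "int (a * b)"
  have "f ` K_verts a b \<subseteq> {0..?n}" using assms(3) unfolding alpha_valuation_def by blast
  then have "?S \<subseteq> {0..}" "?L \<subseteq> {..?n}" unfolding V_small_def V_large_def by auto
  \<comment> \<open>The bounds make the passage through \<open>nat\<close> lossless, and reflecting
    twice is the identity.\<close>
  then have "int ` nat ` ?S = ?S" "(\<lambda>b. ?n - b) ` int ` nat ` (\<lambda>y. ?n - y) ` ?L = ?L"
    by (force simp: image_image)+
  moreover have "a * b > 0" using assms by simp
  ultimately show ?thesis
    using tiles_imp_blowups[OF alpha_valuation_tiles[OF assms]] by metis
qed

end
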